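(* Let $A$ be any mv-algebra and let $a_1,a_2\in A$ be any two elements. Then the following commutative square of canonical quotient morphisms, which is a pushout diagram in the category of mv-algebras, is also a pullback diagram: $$\begin{array}{ccc} A/(a_1\wedge a_2) & \longrightarrow & A/(a_1)\\ \downarrow & & \downarrow\\ A/(a_2) & \longrightarrow & A/(a_1\vee a_2)\end{array}$$
   Context: An mv-algebra is a set $A$ with a binary operation $\oplus$, a unary operation $\neg$ and a constant $0$ such that $(A,\oplus,0)$ is a commutative monoid, $\neg\neg x = x$, $x\oplus\neg 0=\neg 0$ and $\neg(\neg x\oplus y)\oplus y=\neg(\neg y\oplus x)\oplus x$. Derived: $1=\neg 0$, $x\ominus y=\neg(\neg x\oplus y)$, $d(x,y)=(x\ominus y)\oplus(y\ominus x)$; $x\le y \iff x\ominus y=0$ is a lattice order with supremum $\vee$ and infimum $\wedge$. Morphisms preserve $\oplus,\neg,0$. An ideal is a subset $I\subset A$ containing $0$, downward closed, and closed under $\oplus$; $(a)$ is the ideal generated by $a$. The quotient $A/I$ is taken by the congruence $x\sim y\iff d(x,y)\in I$. The pullback property means: for $b_1,b_2\in A$ with the same class in $A/(a_1\vee a_2)$ there is $b\in A$, unique modulo $(a_1\wedge a_2)$, having the same class as $b_1$ in $A/(a_1)$ and the same class as $b_2$ in $A/(a_2)$. *)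

theory Defs
  imports "HOL-Algebra.Group"
begin

record 'a mv_algebra = "'a partial_object" +
  mv_add  :: "'a \<Rightarrow> 'a \<Rightarrow> 'a" (infixl \<open>\<oplus>\<index>\<close> 65)
  mv_neg  :: "'a \<Rightarrow> 'a" (\<open>\<sim>\<index> _\<close> [81] 80)
  mv_zero :: 'a (\<open>\<zero>\<index>\<close>)

locale mv_algebra =
  fixes A :: "'a mv_algebra" (structure)
  assumes add_monoid: "comm_monoid \<lparr>carrier = carrier A, mult = mv_add A, one = mv_zero A\<rparr>"
    and neg_closed: "x \<in> carrier A \<Longrightarrow> \<sim> x \<in> carrier A"
    and neg_neg: "x \<in> carrier A \<Longrightarrow> \<sim> (\<sim> x) = x"
    and add_neg_zero: "x \<in> carrier A \<Longrightarrow> x \<oplus> \<sim> \<zero> = \<sim> \<zero>"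
    and exchange: "\<lbrakk>x \<in> carrier A; y \<in> carrier A\<rbrakk> \<Longrightarrow>
      \<sim> (\<sim> x \<oplus> y) \<oplus> y = \<sim> (\<sim> y \<oplus> x) \<oplus> x"

definition mv_diff :: "'a mv_algebra \<Rightarrow> 'a \<Rightarrow> 'a \<Rightarrow> 'a" where
  "mv_diff A x y = \<sim>\<^bsub>A\<^esub> (\<sim>\<^bsub>A\<^esub> x \<oplus>\<^bsub>A\<^esub> y)"

definition mv_dist :: "'a mv_algebra \<Rightarrow> 'a \<Rightarrow> 'a \<Rightarrow> 'a" where
  "mv_dist A x y = mv_diff A x y \<oplus>\<^bsub>A\<^esub> mv_diff A y x"

definition mv_le :: "'a mv_algebra \<Rightarrow> 'a \<Rightarrow> 'a \<Rightarrow> bool" where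
  "mv_le A x y \<longleftrightarrow> mv_diff A x y = \<zero>\<^bsub>A\<^esub>"

definition mv_order :: "'a mv_algebra \<Rightarrow> 'a gorder" where
  "mv_order A = \<lparr>carrier = carrier A, eq = (=), le = mv_le A\<rparr>"

definition mv_sup :: "'a mv_algebra \<Rightarrow> 'a \<Rightarrow> 'a \<Rightarrow> 'a" where
  "mv_sup A x y = x \<squnion>\<^bsub>mv_order A\<^esub> y"

definition mv_inf :: "'a mv_algebra \<Rightarrow> 'a \<Rightarrow> 'a \<Rightarrow> 'a" where
  "mv_inf A x y = x \<sqinter>\<^bsub>mv_order A\<^esub> y"

text \<open>As for \<^const>\<open>hom\<close>, morphisms are unconstrained off the carrier, so uniqueness of a
  morphism always means uniqueness on the carrier of its domain.\<close>

definition mv_hom :: "'a mv_algebra \<Rightarrow> 'b mv_algebra \<Rightarrow> ('a \<Rightarrow> 'b) set" where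
  "mv_hom A B = {f \<in> carrier A \<rightarrow> carrier B.
     (\<forall>x \<in> carrier A. \<forall>y \<in> carrier A. f (x \<oplus>\<^bsub>A\<^esub> y) = f x \<oplus>\<^bsub>B\<^esub> f y) \<and>
     (\<forall>x \<in> carrier A. f (\<sim>\<^bsub>A\<^esub> x) = \<sim>\<^bsub>B\<^esub> f x) \<and>
     f \<zero>\<^bsub>A\<^esub> = \<zero>\<^bsub>B\<^esub>}"

definition mv_ideal :: "'a mv_algebra \<Rightarrow> 'a set \<Rightarrow> bool" where
  "mv_ideal A I \<longleftrightarrow> I \<subseteq> carrier A \<and> \<zero>\<^bsub>A\<^esub> \<in> I \<and>
     (\<forall>x \<in> carrier A. \<forall>y \<in> I. mv_le A x y \<longrightarrow> x \<in> I) \<and>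
     (\<forall>x \<in> I. \<forall>y \<in> I. x \<oplus>\<^bsub>A\<^esub> y \<in> I)"

definition mv_principal :: "'a mv_algebra \<Rightarrow> 'a \<Rightarrow> 'a set" where
  "mv_principal A a = \<Inter> {I. mv_ideal A I \<and> a \<in> I}"

definition mv_cong :: "'a mv_algebra \<Rightarrow> 'a set \<Rightarrow> ('a \<times> 'a) set" where
  "mv_cong A I = {(x, y) \<in> carrier A \<times> carrier A. mv_dist A x y \<in> I}"

definition mv_class :: "'a mv_algebra \<Rightarrow> 'a set \<Rightarrow> 'a \<Rightarrow> 'a set" where
  "mv_class A I x = mv_cong A I `` {x}"

text \<open>The unions below are over identical sets, because the operations respect the congruence;
  they stand for a choice of representatives.\<close>

definition mv_quot :: "'a mv_algebra \<Rightarrow> 'a set \<Rightarrow> 'a set mv_algebra" where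
  "mv_quot A I =
    \<lparr>carrier = carrier A // mv_cong A I,
     mv_add = \<lambda>X Y. \<Union>x \<in> X. \<Union>y \<in> Y. mv_class A I (x \<oplus>\<^bsub>A\<^esub> y),
     mv_neg = \<lambda>X. \<Union>x \<in> X. mv_class A I (\<sim>\<^bsub>A\<^esub> x),
     mv_zero = mv_class A I \<zero>\<^bsub>A\<^esub>\<rparr>"

text \<open>For ideals \<open>I \<subseteq> J\<close>, the canonical morphism from \<open>A/I\<close> to \<open>A/J\<close>, sending the
  \<open>I\<close>-class of \<open>x\<close> to the \<open>J\<close>-class of \<open>x\<close>; it does not depend on \<open>I\<close>.\<close>

definition mv_quot_map :: "'a mv_algebra \<Rightarrow> 'a set \<Rightarrow> 'a set \<Rightarrow> 'a set" where
  "mv_quot_map A J X = (\<Union>x \<in> X. mv_class A J x)"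

abbreviation mv_quot_by :: "'a mv_algebra \<Rightarrow> 'a \<Rightarrow> 'a set mv_algebra" where
  "mv_quot_by A a \<equiv> mv_quot A (mv_principal A a)"

abbreviation mv_map_by :: "'a mv_algebra \<Rightarrow> 'a \<Rightarrow> 'a set \<Rightarrow> 'a set" where
  "mv_map_by A a \<equiv> mv_quot_map A (mv_principal A a)"

abbreviation mv_class_by :: "'a mv_algebra \<Rightarrow> 'a \<Rightarrow> 'a \<Rightarrow> 'a set" where
  "mv_class_by A a \<equiv> mv_class A (mv_principal A a)"

text \<open>A commutative square of mv-algebras and morphisms
  \<open>p : P \<rightarrow> B\<close>, \<open>q : P \<rightarrow> C\<close>, \<open>r : B \<rightarrow> D\<close>, \<open>s : C \<rightarrow> D\<close>.\<close>

definition mv_square ::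
  "'p mv_algebra \<Rightarrow> 'b mv_algebra \<Rightarrow> 'c mv_algebra \<Rightarrow> 'd mv_algebra \<Rightarrow>
   ('p \<Rightarrow> 'b) \<Rightarrow> ('p \<Rightarrow> 'c) \<Rightarrow> ('b \<Rightarrow> 'd) \<Rightarrow> ('c \<Rightarrow> 'd) \<Rightarrow> bool" where
  "mv_square P B C D p q r s \<longleftrightarrow>
     mv_algebra P \<and> mv_algebra B \<and> mv_algebra C \<and> mv_algebra D \<and>
     p \<in> mv_hom P B \<and> q \<in> mv_hom P C \<and> r \<in> mv_hom B D \<and> s \<in> mv_hom C D \<and>
     (\<forall>x \<in> carrier P. r (p x) = s (q x))"

text \<open>A universal property quantifies over all mv-algebras, but a HOL formula can only quantify
  over those on one type. That type is the first argument; leaving it a type variable in a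
  theorem makes the property hold for test objects on every type.\<close>

definition mv_pullback :: "'t itself \<Rightarrow>
   'p mv_algebra \<Rightarrow> 'b mv_algebra \<Rightarrow> 'c mv_algebra \<Rightarrow> 'd mv_algebra \<Rightarrow>
   ('p \<Rightarrow> 'b) \<Rightarrow> ('p \<Rightarrow> 'c) \<Rightarrow> ('b \<Rightarrow> 'd) \<Rightarrow> ('c \<Rightarrow> 'd) \<Rightarrow> bool" where
  "mv_pullback (ty :: 't itself) P B C D p q r s \<longleftrightarrow>
     mv_square P B C D p q r s \<and>
     (\<forall>(T :: 't mv_algebra) f g.
        mv_algebra T \<and> f \<in> mv_hom T B \<and> g \<in> mv_hom T C \<and>
        (\<forall>t \<in> carrier T. r (f t) = s (g t)) \<longrightarrow>
        (\<exists>h \<in> mv_hom T P.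
           (\<forall>t \<in> carrier T. p (h t) = f t \<and> q (h t) = g t) \<and>
           (\<forall>h' \<in> mv_hom T P.
              (\<forall>t \<in> carrier T. p (h' t) = f t \<and> q (h' t) = g t) \<longrightarrow>
              (\<forall>t \<in> carrier T. h' t = h t))))"

definition mv_pushout :: "'t itself \<Rightarrow>
   'p mv_algebra \<Rightarrow> 'b mv_algebra \<Rightarrow> 'c mv_algebra \<Rightarrow> 'd mv_algebra \<Rightarrow>
   ('p \<Rightarrow> 'b) \<Rightarrow> ('p \<Rightarrow> 'c) \<Rightarrow> ('b \<Rightarrow> 'd) \<Rightarrow> ('c \<Rightarrow> 'd) \<Rightarrow> bool" where
  "mv_pushout (ty :: 't itself) P B C D p q r s \<longleftrightarrow>
     mv_square P B C D p q r s \<and>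
     (\<forall>(T :: 't mv_algebra) f g.
        mv_algebra T \<and> f \<in> mv_hom B T \<and> g \<in> mv_hom C T \<and>
        (\<forall>x \<in> carrier P. f (p x) = g (q x)) \<longrightarrow>
        (\<exists>h \<in> mv_hom D T.
           (\<forall>b \<in> carrier B. h (r b) = f b) \<and> (\<forall>c \<in> carrier C. h (s c) = g c) \<and>
           (\<forall>h' \<in> mv_hom D T.
              (\<forall>b \<in> carrier B. h' (r b) = f b) \<and> (\<forall>c \<in> carrier C. h' (s c) = g c) \<longrightarrow>
              (\<forall>d \<in> carrier D. h' d = h d))))"

end

theory Submission
  imports Defs
begin

text \<open>
  Work with arbitrary ideals \<open>I\<close> and \<open>J\<close>. The square of quotients by \<open>I \<inter> J\<close>, \<open>I\<close>, \<open>J\<close> and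
  the ideal sum \<open>I + J\<close> is always both a pushout and a pullback, and for \<open>I = (a\<^sub>1)\<close>,
  \<open>J = (a\<^sub>2)\<close> the two outer ideals turn out to be \<open>(a\<^sub>1 \<and> a\<^sub>2)\<close> and \<open>(a\<^sub>1 \<or> a\<^sub>2)\<close>
  (\<open>principal_inf\<close>, \<open>principal_sup\<close>).

  The engine of every computation is residuation (\<open>diff_le_iff\<close>): truncated subtraction is
  adjoint to addition, \<open>x \<ominus> y \<le> z\<close> exactly when \<open>x \<le> y \<oplus> z\<close>. It lets inequalities
  be handled as in a lattice-ordered group, without representing \<open>A\<close> by totally ordered algebras.

  The pushout property is formal. A compatible pair of morphisms amounts to a morphism from \<open>A\<close>
  whose kernel contains both \<open>I\<close> and \<open>J\<close>; kernels are ideals, so it contains \<open>I + J\<close> and the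
  morphism factors (\<open>hom_factors\<close>).

  The pullback property is a Chinese remainder theorem (\<open>chinese_remainder\<close>). If \<open>b\<^sub>1\<close> and \<open>b\<^sub>2\<close>
  agree modulo \<open>I + J\<close>, their distance is at most \<open>i \<oplus> j\<close> with \<open>i \<in> I\<close> and \<open>j \<in> J\<close>. Truncating
  \<open>b\<^sub>2\<close> to the interval from \<open>b\<^sub>1 \<ominus> i\<close> to \<open>b\<^sub>1 \<oplus> i\<close> moves it by at most \<open>j\<close>, so the result agrees
  with \<open>b\<^sub>1\<close> modulo \<open>I\<close> and with \<open>b\<^sub>2\<close> modulo \<open>J\<close>. Uniqueness modulo \<open>I \<inter> J\<close> is immediate.
\<close>

section \<open>Order and residuation\<close>

context mv_algebra
begin

abbreviation diff (infixl \<open>\<ominus>\<close> 65) where "x \<ominus> y \<equiv> mv_diff A x y"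
abbreviation le (infix \<open>\<preceq>\<close> 50) where "x \<preceq> y \<equiv> mv_le A x y"

lemma add_closed [simp]: "\<lbrakk>x \<in> carrier A; y \<in> carrier A\<rbrakk> \<Longrightarrow> x \<oplus> y \<in> carrier A"
  using monoid.m_closed[OF comm_monoid.axioms(1)[OF add_monoid]] by simp

lemma zero_closed [simp]: "\<zero> \<in> carrier A"
  using monoid.one_closed[OF comm_monoid.axioms(1)[OF add_monoid]] by simp

lemma add_assoc: "\<lbrakk>x \<in> carrier A; y \<in> carrier A; z \<in> carrier A\<rbrakk>
    \<Longrightarrow> (x \<oplus> y) \<oplus> z = x \<oplus> (y \<oplus> z)"
  using monoid.m_assoc[OF comm_monoid.axioms(1)[OF add_monoid]] by simp

lemma add_comm: "\<lbrakk>x \<in> carrier A; y \<in> carrier A\<rbrakk> \<Longrightarrow> x \<oplus> y = y \<oplus> x"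
  using comm_monoid.m_comm[OF add_monoid] by simp

lemma add_left_comm: "\<lbrakk>x \<in> carrier A; y \<in> carrier A; z \<in> carrier A\<rbrakk>
    \<Longrightarrow> x \<oplus> (y \<oplus> z) = y \<oplus> (x \<oplus> z)"
  by (metis add_assoc add_comm)

lemmas add_ac = add_assoc add_comm add_left_comm

lemma zero_add [simp]: "x \<in> carrier A \<Longrightarrow> \<zero> \<oplus> x = x"
  using monoid.l_one[OF comm_monoid.axioms(1)[OF add_monoid]] by simp

lemma add_zero [simp]: "x \<in> carrier A \<Longrightarrow> x \<oplus> \<zero> = x"
  by (simp add: add_comm[of x])

declare neg_closed [simp] neg_neg [simp] add_neg_zero [simp]

lemma neg_zero_add [simp]: "x \<in> carrier A \<Longrightarrow> \<sim> \<zero> \<oplus> x = \<sim> \<zero>"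
  by (simp add: add_comm)

lemma diff_closed [simp]: "\<lbrakk>x \<in> carrier A; y \<in> carrier A\<rbrakk> \<Longrightarrow> x \<ominus> y \<in> carrier A"
  by (simp add: mv_diff_def)

lemma le_iff: "\<lbrakk>x \<in> carrier A; y \<in> carrier A\<rbrakk> \<Longrightarrow> x \<preceq> y \<longleftrightarrow> \<sim> x \<oplus> y = \<sim> \<zero>"
  unfolding mv_le_def mv_diff_def by (metis add_closed neg_closed neg_neg zero_closed)

text \<open>The exchange axiom, applied to \<open>x\<close> and the unit, yields the law of excluded middle
  \<open>\<sim> x \<oplus> x = \<sim> \<zero>\<close>.\<close>

lemma le_refl [simp]: "x \<in> carrier A \<Longrightarrow> x \<preceq> x"
  using exchange[of x "\<sim> \<zero>"] by (simp add: le_iff)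

lemma le_antisym: "\<lbrakk>x \<preceq> y; y \<preceq> x; x \<in> carrier A; y \<in> carrier A\<rbrakk> \<Longrightarrow> x = y"
  using exchange[of x y] by (simp add: le_iff)

lemma zero_le [simp]: "x \<in> carrier A \<Longrightarrow> \<zero> \<preceq> x"
  by (simp add: le_iff)

lemma le_zeroD: "\<lbrakk>x \<preceq> \<zero>; x \<in> carrier A\<rbrakk> \<Longrightarrow> x = \<zero>"
  by (simp add: le_antisym)

lemma diff_add_comm: "\<lbrakk>x \<in> carrier A; y \<in> carrier A\<rbrakk> \<Longrightarrow> (x \<ominus> y) \<oplus> y = (y \<ominus> x) \<oplus> x"
  unfolding mv_diff_def by (rule exchange)

lemma diff_add_cancel:
  assumes "x \<preceq> y" and "x \<in> carrier A" and "y \<in> carrier A"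
  shows "(y \<ominus> x) \<oplus> x = y"
  using diff_add_comm[of x y] assms by (simp add: mv_le_def)

lemma le_add [simp]: "\<lbrakk>x \<in> carrier A; y \<in> carrier A\<rbrakk> \<Longrightarrow> x \<preceq> x \<oplus> y"
  using le_refl[of x] by (simp add: le_iff add_assoc[symmetric] del: le_refl)

lemma le_add' [simp]: "\<lbrakk>x \<in> carrier A; y \<in> carrier A\<rbrakk> \<Longrightarrow> x \<preceq> y \<oplus> x"
  by (simp add: add_comm[of y])

lemma le_trans:
  assumes "x \<preceq> y" and "y \<preceq> z" and [simp]: "x \<in> carrier A" "y \<in> carrier A" "z \<in> carrier A"
  shows "x \<preceq> z"
proof -
  have "\<sim> x \<oplus> z = (\<sim> x \<oplus> y) \<oplus> (z \<ominus> y)"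
    by (subst diff_add_cancel[of y z, symmetric]) (simp_all add: assms(2) add_ac)
  with assms(1) show ?thesis by (simp add: le_iff)
qed

text \<open>Both inequalities say \<open>\<sim> x \<oplus> y \<oplus> z = \<sim> \<zero>\<close>.\<close>

lemma diff_le_iff:
  assumes "x \<in> carrier A" and "y \<in> carrier A" and "z \<in> carrier A"
  shows "x \<ominus> y \<preceq> z \<longleftrightarrow> x \<preceq> y \<oplus> z"
  using assms by (simp add: le_iff mv_diff_def add_assoc)

lemma add_mono:
  assumes "x \<preceq> y" and "u \<preceq> v"
    and [simp]: "x \<in> carrier A" "y \<in> carrier A" "u \<in> carrier A" "v \<in> carrier A"
  shows "x \<oplus> u \<preceq> y \<oplus> v"
proof -
  have "y \<oplus> v = ((y \<ominus> x) \<oplus> x) \<oplus> ((v \<ominus> u) \<oplus> u)"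
    using assms by (simp add: diff_add_cancel)
  also have "\<dots> = (x \<oplus> u) \<oplus> ((y \<ominus> x) \<oplus> (v \<ominus> u))"
    by (simp add: add_ac)
  finally show ?thesis by simp
qed

lemma diff_le [simp]: "\<lbrakk>x \<in> carrier A; y \<in> carrier A\<rbrakk> \<Longrightarrow> x \<ominus> y \<preceq> x"
  by (simp add: diff_le_iff)

lemma le_add_diff: "\<lbrakk>x \<in> carrier A; y \<in> carrier A\<rbrakk> \<Longrightarrow> x \<preceq> y \<oplus> (x \<ominus> y)"
  by (simp add: diff_le_iff[symmetric])

lemma diff_diff_le: "\<lbrakk>x \<in> carrier A; y \<in> carrier A\<rbrakk> \<Longrightarrow> x \<ominus> (x \<ominus> y) \<preceq> y"
  by (simp add: diff_le_iff add_comm[of "x \<ominus> y"] le_add_diff)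

lemma neg_le_neg: "\<lbrakk>x \<in> carrier A; y \<in> carrier A\<rbrakk> \<Longrightarrow> \<sim> x \<preceq> \<sim> y \<longleftrightarrow> y \<preceq> x"
  by (simp add: le_iff add_comm)

section \<open>Suprema and infima\<close>

lemma diff_add_least:
  assumes "x \<preceq> z" and "y \<preceq> z" and [simp]: "x \<in> carrier A" "y \<in> carrier A" "z \<in> carrier A"
  shows "(x \<ominus> y) \<oplus> y \<preceq> z"
proof -
  have "x \<ominus> y \<preceq> z \<ominus> y"
    using assms by (simp add: diff_le_iff add_comm[of y] diff_add_cancel)
  then have "(x \<ominus> y) \<oplus> y \<preceq> (z \<ominus> y) \<oplus> y"
    by (simp add: add_mono)
  with assms(2) show ?thesis by (simp add: diff_add_cancel)
qed

text \<open>The supremum in \<^const>\<open>mv_sup\<close> is a choice of a least upper bound, so it has its properties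
  once one least upper bound is exhibited.\<close>

lemma mv_sup_least:
  assumes [simp]: "x \<in> carrier A" "y \<in> carrier A"
  shows "least (mv_order A) (mv_sup A x y) (Upper (mv_order A) {x, y})"
proof -
  have "x \<preceq> (x \<ominus> y) \<oplus> y" by (subst diff_add_comm) simp_all
  then have "least (mv_order A) ((x \<ominus> y) \<oplus> y) (Upper (mv_order A) {x, y})"
    by (auto simp: least_def Upper_def mv_order_def diff_add_least)
  then show ?thesis
    unfolding mv_sup_def join_def sup_def by (rule someI)
qed

text \<open>Negation is an order-reversing involution, so it turns suprema into infima.\<close>

lemma mv_inf_greatest:
  assumes [simp]: "x \<in> carrier A" "y \<in> carrier A"
  shows "greatest (mv_order A) (mv_inf A x y) (Lower (mv_order A) {x, y})"
proof -
  let ?s = "mv_sup A (\<sim> x) (\<sim> y)"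
  have s: "?s \<in> carrier A" "\<sim> x \<preceq> ?s" "\<sim> y \<preceq> ?s"
    and s_le: "\<And>z. \<lbrakk>\<sim> x \<preceq> z; \<sim> y \<preceq> z; z \<in> carrier A\<rbrakk> \<Longrightarrow> ?s \<preceq> z"
    using mv_sup_least[of "\<sim> x" "\<sim> y"] by (auto simp: least_def Upper_def mv_order_def)
  have "\<sim> ?s \<preceq> x" "\<sim> ?s \<preceq> y"
    using s neg_le_neg[of ?s "\<sim> x"] neg_le_neg[of ?s "\<sim> y"] by auto
  moreover have "z \<preceq> \<sim> ?s" if "z \<preceq> x" "z \<preceq> y" "z \<in> carrier A" for z
    using that s_le[of "\<sim> z"] s(1) neg_le_neg[of "\<sim> z" ?s] by (simp add: neg_le_neg)
  ultimately have "greatest (mv_order A) (\<sim> ?s) (Lower (mv_order A) {x, y})"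
    using s(1) by (auto simp: greatest_def Lower_def mv_order_def)
  then show ?thesis
    unfolding mv_inf_def meet_def inf_def by (rule someI)
qed

lemma mv_sup:
  assumes "x \<in> carrier A" and "y \<in> carrier A"
  shows mv_sup_closed: "mv_sup A x y \<in> carrier A"
    and le_mv_sup1: "x \<preceq> mv_sup A x y"
    and le_mv_sup2: "y \<preceq> mv_sup A x y"
    and mv_sup_le: "\<lbrakk>x \<preceq> z; y \<preceq> z; z \<in> carrier A\<rbrakk> \<Longrightarrow> mv_sup A x y \<preceq> z"
  using mv_sup_least[OF assms] assms by (auto simp: least_def Upper_def mv_order_def)

lemma mv_inf:
  assumes "x \<in> carrier A" and "y \<in> carrier A"
  shows mv_inf_closed: "mv_inf A x y \<in> carrier A"
    and mv_inf_le1: "mv_inf A x y \<preceq> x"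
    and mv_inf_le2: "mv_inf A x y \<preceq> y"
    and le_mv_inf: "\<lbrakk>z \<preceq> x; z \<preceq> y; z \<in> carrier A\<rbrakk> \<Longrightarrow> z \<preceq> mv_inf A x y"
  using mv_inf_greatest[OF assms] assms by (auto simp: greatest_def Lower_def mv_order_def)

section \<open>Ideals\<close>

lemma idealD:
  assumes "mv_ideal A I"
  shows ideal_carrier: "x \<in> I \<Longrightarrow> x \<in> carrier A"
    and ideal_zero: "\<zero> \<in> I"
    and ideal_down: "\<lbrakk>x \<preceq> y; y \<in> I; x \<in> carrier A\<rbrakk> \<Longrightarrow> x \<in> I"
    and ideal_add: "\<lbrakk>x \<in> I; y \<in> I\<rbrakk> \<Longrightarrow> x \<oplus> y \<in> I"
  using assms unfolding mv_ideal_def by blast+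

lemma ideal_diff_iff:
  assumes "mv_ideal A I" and [simp]: "x \<in> carrier A" "y \<in> carrier A"
  shows "x \<ominus> y \<in> I \<longleftrightarrow> (\<exists>i\<in>I. x \<preceq> y \<oplus> i)"
proof
  assume "x \<ominus> y \<in> I"
  then show "\<exists>i\<in>I. x \<preceq> y \<oplus> i" using le_add_diff[of x y] by auto
next
  assume "\<exists>i\<in>I. x \<preceq> y \<oplus> i"
  then obtain i where "i \<in> I" "x \<preceq> y \<oplus> i" by blast
  moreover have "i \<in> carrier A" using \<open>i \<in> I\<close> assms(1) by (simp add: ideal_carrier)
  ultimately show "x \<ominus> y \<in> I"
    using ideal_down[OF assms(1), of "x \<ominus> y" i] by (simp add: diff_le_iff)
qed

lemma ideal_Inter:
  assumes "F \<noteq> {}" and ideal: "\<And>I. I \<in> F \<Longrightarrow> mv_ideal A I"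
  shows "mv_ideal A (\<Inter> F)"
proof -
  from assms(1) obtain I where I: "I \<in> F" by blast
  have "x \<in> carrier A" if "x \<in> \<Inter> F" for x
    using that I ideal_carrier[OF ideal[OF I]] by blast
  moreover have "\<zero> \<in> \<Inter> F"
    using ideal_zero[OF ideal] by blast
  moreover have "x \<in> \<Inter> F" if "x \<in> carrier A" "y \<in> \<Inter> F" "x \<preceq> y" for x y
    using that ideal_down[OF ideal that(3)] by blast
  moreover have "x \<oplus> y \<in> \<Inter> F" if "x \<in> \<Inter> F" "y \<in> \<Inter> F" for x y
    using that ideal_add[OF ideal] by blast
  ultimately show ?thesis
    unfolding mv_ideal_def by blast
qed

lemma principal_ideal:
  assumes "a \<in> carrier A"
  shows "mv_ideal A (mv_principal A a)"
  unfolding mv_principal_def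
proof (rule ideal_Inter)
  have "mv_ideal A (carrier A)" by (simp add: mv_ideal_def)
  with assms show "{I. mv_ideal A I \<and> a \<in> I} \<noteq> {}" by blast
qed simp

lemma principal_self: "a \<in> mv_principal A a"
  by (simp add: mv_principal_def)

lemma principal_subset_iff:
  assumes "mv_ideal A I"
  shows "mv_principal A a \<subseteq> I \<longleftrightarrow> a \<in> I"
proof
  show "a \<in> I" if "mv_principal A a \<subseteq> I" using that principal_self by blast
  show "mv_principal A a \<subseteq> I" if "a \<in> I"
    using that assms unfolding mv_principal_def by (intro Inter_lower) simp
qed

lemma ideal_Int: "\<lbrakk>mv_ideal A I; mv_ideal A J\<rbrakk> \<Longrightarrow> mv_ideal A (I \<inter> J)"
  using ideal_Inter[of "{I, J}"] by auto

definition ideal_sum :: "'a set \<Rightarrow> 'a set \<Rightarrow> 'a set" where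
  "ideal_sum I J = {x \<in> carrier A. \<exists>i\<in>I. \<exists>j\<in>J. x \<preceq> i \<oplus> j}"

lemma ideal_sum_ideal:
  assumes I: "mv_ideal A I" and J: "mv_ideal A J"
  shows "mv_ideal A (ideal_sum I J)"
  unfolding mv_ideal_def
proof (intro conjI ballI impI)
  show "ideal_sum I J \<subseteq> carrier A" by (auto simp: ideal_sum_def)
  show "\<zero> \<in> ideal_sum I J"
    using ideal_zero[OF I] ideal_zero[OF J] by (force simp: ideal_sum_def)
next
  fix x y assume x: "x \<in> carrier A" "x \<preceq> y" and y: "y \<in> ideal_sum I J"
  then obtain i j where ij: "i \<in> I" "j \<in> J" and "y \<in> carrier A" "y \<preceq> i \<oplus> j"
    by (auto simp: ideal_sum_def)
  then have "x \<preceq> i \<oplus> j"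
    using x le_trans[of x y "i \<oplus> j"] ideal_carrier[OF I] ideal_carrier[OF J] by simp
  with x ij show "x \<in> ideal_sum I J"
    by (auto simp: ideal_sum_def)
next
  fix x y assume "x \<in> ideal_sum I J" "y \<in> ideal_sum I J"
  then obtain i j i' j' where *: "x \<in> carrier A" "y \<in> carrier A" "i \<in> I" "j \<in> J"
      "i' \<in> I" "j' \<in> J" "x \<preceq> i \<oplus> j" "y \<preceq> i' \<oplus> j'"
    by (auto simp: ideal_sum_def)
  have [simp]: "i \<in> carrier A" "j \<in> carrier A" "i' \<in> carrier A" "j' \<in> carrier A"
    using * ideal_carrier[OF I] ideal_carrier[OF J] by auto
  have "x \<oplus> y \<preceq> (i \<oplus> j) \<oplus> (i' \<oplus> j')"
    using * by (simp add: add_mono)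
  also have "(i \<oplus> j) \<oplus> (i' \<oplus> j') = (i \<oplus> i') \<oplus> (j \<oplus> j')"
    by (simp add: add_ac)
  finally show "x \<oplus> y \<in> ideal_sum I J"
    using * ideal_add[OF I, of i i'] ideal_add[OF J, of j j'] by (auto simp: ideal_sum_def)
qed

lemma ideal_sum_upper:
  assumes I: "mv_ideal A I" and J: "mv_ideal A J"
  shows "I \<subseteq> ideal_sum I J" and "J \<subseteq> ideal_sum I J"
proof -
  show "I \<subseteq> ideal_sum I J"
    using ideal_carrier[OF I] ideal_zero[OF J] by (force simp: ideal_sum_def)
  show "J \<subseteq> ideal_sum I J"
    using ideal_carrier[OF J] ideal_zero[OF I] by (force simp: ideal_sum_def)
qed

lemma ideal_sum_least:
  assumes "mv_ideal A K" and "I \<subseteq> K" and "J \<subseteq> K"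
  shows "ideal_sum I J \<subseteq> K"
proof
  fix x assume "x \<in> ideal_sum I J"
  then obtain i j where "x \<in> carrier A" "i \<in> I" "j \<in> J" "x \<preceq> i \<oplus> j"
    by (auto simp: ideal_sum_def)
  moreover from this have "i \<oplus> j \<in> K"
    using assms by (auto intro: ideal_add)
  ultimately show "x \<in> K"
    using ideal_down[OF assms(1)] by simp
qed

text \<open>An ideal contains \<open>a \<or> b\<close> exactly when it contains both \<open>a\<close> and \<open>b\<close>, because \<open>a \<or> b\<close> lies
  below \<open>a \<oplus> b\<close>.\<close>

lemma principal_sup:
  assumes a: "a \<in> carrier A" and b: "b \<in> carrier A"
  shows "mv_principal A (mv_sup A a b) = ideal_sum (mv_principal A a) (mv_principal A b)"
proof
  let ?I = "mv_principal A a" and ?J = "mv_principal A b" and ?K = "mv_principal A (mv_sup A a b)"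
  have K: "mv_ideal A ?K" using a b by (simp add: principal_ideal mv_sup_closed)
  have "a \<in> ?K" "b \<in> ?K"
    using ideal_down[OF K _ principal_self] le_mv_sup1 le_mv_sup2 a b by auto
  then show "ideal_sum ?I ?J \<subseteq> ?K"
    by (simp add: ideal_sum_least[OF K] principal_subset_iff[OF K])
  have "mv_sup A a b \<preceq> a \<oplus> b" using a b by (simp add: mv_sup_le)
  then have "mv_sup A a b \<in> ideal_sum ?I ?J"
    using a b principal_self by (auto simp: ideal_sum_def mv_sup_closed)
  then show "?K \<subseteq> ideal_sum ?I ?J"
    using a b by (simp add: principal_subset_iff ideal_sum_ideal principal_ideal)
qed

text \<open>An element \<open>x\<close> belongs to this set exactly when \<open>x \<and> y \<in> I\<close>, so this is the ideal quotient
  of \<open>I\<close> by \<open>y\<close>. For closure under addition, let \<open>z\<close> lie below \<open>x \<oplus> x'\<close> and below \<open>y\<close>, and split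
  it as \<open>z \<le> (z \<ominus> x) \<oplus> (z \<ominus> (z \<ominus> x))\<close>: by residuation the first part lies below \<open>x'\<close> and the
  second below \<open>x\<close>, and both lie below \<open>z \<le> y\<close>.\<close>

lemma ideal_quotient:
  assumes I: "mv_ideal A I" and [simp]: "y \<in> carrier A"
  shows "mv_ideal A {x \<in> carrier A. \<forall>z\<in>carrier A. z \<preceq> x \<and> z \<preceq> y \<longrightarrow> z \<in> I}"
    (is "mv_ideal A ?K")
  unfolding mv_ideal_def
proof (intro conjI ballI impI)
  show "?K \<subseteq> carrier A" by auto
  show "\<zero> \<in> ?K" using le_zeroD ideal_zero[OF I] by auto
next
  fix x x' assume "x \<in> carrier A" "x' \<in> ?K" "x \<preceq> x'"
  then show "x \<in> ?K" using le_trans by blast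
next
  fix x x' assume x: "x \<in> ?K" and x': "x' \<in> ?K"
  then have [simp]: "x \<in> carrier A" "x' \<in> carrier A" by auto
  have "z \<in> I" if [simp]: "z \<in> carrier A" and z: "z \<preceq> x \<oplus> x'" "z \<preceq> y" for z
  proof -
    have "z \<ominus> x \<preceq> x'" using z by (simp add: diff_le_iff)
    moreover have "z \<ominus> x \<preceq> y" using z le_trans[of "z \<ominus> x" z y] by simp
    ultimately have "z \<ominus> x \<in> I" using x' by simp
    moreover have "z \<ominus> (z \<ominus> x) \<preceq> y" using z le_trans[of "z \<ominus> (z \<ominus> x)" z y] by simp
    then have "z \<ominus> (z \<ominus> x) \<in> I" using x by (simp add: diff_diff_le)
    ultimately show ?thesis
      using ideal_down[OF I le_add_diff[of z "z \<ominus> x"]] ideal_add[OF I] by simp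
  qed
  then show "x \<oplus> x' \<in> ?K" by simp
qed

text \<open>For the inclusion of \<open>(a) \<inter> (b)\<close> in \<open>K = (a \<and> b)\<close>, use ideal quotients twice: the quotient
  of \<open>K\<close> by \<open>b\<close> contains \<open>a\<close>, hence \<open>(a)\<close>; so for \<open>x \<in> (a)\<close> the quotient of \<open>K\<close> by \<open>x\<close> contains
  \<open>b\<close>, hence \<open>(b)\<close>. If also \<open>x \<in> (b)\<close>, then \<open>x = x \<and> x \<in> K\<close>.\<close>

lemma principal_inf:
  assumes [simp]: "a \<in> carrier A" "b \<in> carrier A"
  shows "mv_principal A (mv_inf A a b) = mv_principal A a \<inter> mv_principal A b"
proof
  let ?I = "mv_principal A a" and ?J = "mv_principal A b" and ?K = "mv_principal A (mv_inf A a b)"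
  let ?Q = "\<lambda>y. {x \<in> carrier A. \<forall>z\<in>carrier A. z \<preceq> x \<and> z \<preceq> y \<longrightarrow> z \<in> ?K}"
  have [simp]: "mv_inf A a b \<in> carrier A" by (simp add: mv_inf_closed)
  have I: "mv_ideal A ?I" and J: "mv_ideal A ?J" and K: "mv_ideal A ?K"
    by (simp_all add: principal_ideal)
  have "mv_inf A a b \<in> ?I" "mv_inf A a b \<in> ?J"
    using ideal_down[OF I mv_inf_le1 principal_self] ideal_down[OF J mv_inf_le2 principal_self]
    by auto
  then show "?K \<subseteq> ?I \<inter> ?J"
    using principal_subset_iff[OF ideal_Int[OF I J]] by simp
  have "a \<in> ?Q b"
    using ideal_down[OF K le_mv_inf principal_self] by simp
  then have I_sub: "?I \<subseteq> ?Q b"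
    using principal_subset_iff[OF ideal_quotient[OF K]] by simp
  show "?I \<inter> ?J \<subseteq> ?K"
  proof
    fix x assume x: "x \<in> ?I \<inter> ?J"
    then have [simp]: "x \<in> carrier A" by (simp add: ideal_carrier[OF I])
    have "b \<in> ?Q x" using x I_sub by auto
    then have "?J \<subseteq> ?Q x"
      using principal_subset_iff[OF ideal_quotient[OF K]] by simp
    with x show "x \<in> ?K" by auto
  qed
qed

section \<open>Congruences and quotients\<close>

lemma cong_iff:
  assumes I: "mv_ideal A I"
  shows "(x, y) \<in> mv_cong A I
    \<longleftrightarrow> x \<in> carrier A \<and> y \<in> carrier A \<and> x \<ominus> y \<in> I \<and> y \<ominus> x \<in> I"
proof -
  have "(x \<ominus> y) \<oplus> (y \<ominus> x) \<in> I \<longleftrightarrow> x \<ominus> y \<in> I \<and> y \<ominus> x \<in> I"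
    if "x \<in> carrier A" "y \<in> carrier A"
    using that ideal_down[OF I, of "x \<ominus> y" "(x \<ominus> y) \<oplus> (y \<ominus> x)"]
      ideal_down[OF I, of "y \<ominus> x" "(x \<ominus> y) \<oplus> (y \<ominus> x)"] ideal_add[OF I] by auto
  then show ?thesis by (auto simp: mv_cong_def mv_dist_def)
qed

lemma diff_triangle:
  assumes [simp]: "x \<in> carrier A" "y \<in> carrier A" "z \<in> carrier A"
  shows "x \<ominus> z \<preceq> (x \<ominus> y) \<oplus> (y \<ominus> z)"
proof -
  have "x \<preceq> y \<oplus> (x \<ominus> y)" by (simp add: le_add_diff)
  moreover have "y \<oplus> (x \<ominus> y) \<preceq> (z \<oplus> (y \<ominus> z)) \<oplus> (x \<ominus> y)"
    by (simp add: add_mono le_add_diff)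
  ultimately have "x \<preceq> (z \<oplus> (y \<ominus> z)) \<oplus> (x \<ominus> y)"
    by (rule le_trans) simp_all
  then show ?thesis by (simp add: diff_le_iff add_ac)
qed

lemma diff_add_le:
  assumes [simp]: "x \<in> carrier A" "y \<in> carrier A" "u \<in> carrier A" "v \<in> carrier A"
  shows "(x \<oplus> u) \<ominus> (y \<oplus> v) \<preceq> (x \<ominus> y) \<oplus> (u \<ominus> v)"
proof -
  have "x \<oplus> u \<preceq> (y \<oplus> (x \<ominus> y)) \<oplus> (v \<oplus> (u \<ominus> v))"
    by (simp add: add_mono le_add_diff)
  then show ?thesis by (simp add: diff_le_iff add_ac)
qed

lemma neg_diff_neg: "\<lbrakk>x \<in> carrier A; y \<in> carrier A\<rbrakk> \<Longrightarrow> \<sim> x \<ominus> \<sim> y = y \<ominus> x"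
  by (simp add: mv_diff_def add_comm)

lemma cong_equiv:
  assumes I: "mv_ideal A I"
  shows "equiv (carrier A) (mv_cong A I)"
proof (rule equivI)
  show "mv_cong A I \<subseteq> carrier A \<times> carrier A" by (auto simp: mv_cong_def)
  show "refl_on (carrier A) (mv_cong A I)"
    using le_refl ideal_zero[OF I] by (simp add: refl_on_def cong_iff[OF I] mv_le_def)
  show "sym (mv_cong A I)"
    by (simp add: sym_def cong_iff[OF I])
  have "x \<ominus> z \<in> I"
    if "x \<ominus> y \<in> I" "y \<ominus> z \<in> I" "x \<in> carrier A" "y \<in> carrier A" "z \<in> carrier A" for x y z
    using ideal_down[OF I diff_triangle ideal_add[OF I that(1,2)]] that by simp
  then show "trans (mv_cong A I)"
    unfolding trans_def cong_iff[OF I] by blast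
qed

lemma cong_add:
  assumes I: "mv_ideal A I" and "(x, y) \<in> mv_cong A I" and "(u, v) \<in> mv_cong A I"
  shows "(x \<oplus> u, y \<oplus> v) \<in> mv_cong A I"
proof -
  have "(x \<oplus> u) \<ominus> (y \<oplus> v) \<in> I"
    if "x \<ominus> y \<in> I" "u \<ominus> v \<in> I"
      "x \<in> carrier A" "y \<in> carrier A" "u \<in> carrier A" "v \<in> carrier A" for x y u v
    using ideal_down[OF I diff_add_le ideal_add[OF I that(1,2)]] that by simp
  with assms(2,3) show ?thesis by (simp add: cong_iff[OF I])
qed

lemma cong_neg:
  assumes I: "mv_ideal A I" and "(x, y) \<in> mv_cong A I"
  shows "(\<sim> x, \<sim> y) \<in> mv_cong A I"
  using assms(2) by (auto simp: cong_iff[OF I] neg_diff_neg)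

lemma class_eq_iff:
  assumes "mv_ideal A I" and "x \<in> carrier A" and "y \<in> carrier A"
  shows "mv_class A I x = mv_class A I y \<longleftrightarrow> x \<ominus> y \<in> I \<and> y \<ominus> x \<in> I"
  using assms eq_equiv_class_iff[OF cong_equiv] by (simp add: mv_class_def cong_iff)

lemma class_eqI:
  assumes "mv_ideal A I" and "(x, y) \<in> mv_cong A I"
  shows "mv_class A I x = mv_class A I y"
  using assms equiv_class_eq[OF cong_equiv] by (simp add: mv_class_def)

lemma quot_carrier: "carrier (mv_quot A I) = mv_class A I ` carrier A"
  by (auto simp: mv_quot_def mv_class_def quotient_def)

lemma quot_zero: "mv_zero (mv_quot A I) = mv_class A I \<zero>"
  by (simp add: mv_quot_def)

lemma quot_add:
  assumes I: "mv_ideal A I" and "x \<in> carrier A" and "y \<in> carrier A"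
  shows "mv_class A I x \<oplus>\<^bsub>mv_quot A I\<^esub> mv_class A I y = mv_class A I (x \<oplus> y)"
proof -
  have "congruent2 (mv_cong A I) (mv_cong A I) (\<lambda>x y. mv_class A I (x \<oplus> y))"
    by (rule congruent2I') (simp add: class_eqI[OF I] cong_add[OF I])
  from UN_equiv_class2[OF cong_equiv[OF I] cong_equiv[OF I] this] assms(2,3)
  show ?thesis by (simp add: mv_quot_def mv_class_def)
qed

lemma quot_neg:
  assumes I: "mv_ideal A I" and "x \<in> carrier A"
  shows "\<sim>\<^bsub>mv_quot A I\<^esub> mv_class A I x = mv_class A I (\<sim> x)"
proof -
  have "congruent (mv_cong A I) (\<lambda>x. mv_class A I (\<sim> x))"
    by (rule congruentI) (simp add: class_eqI[OF I] cong_neg[OF I])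
  from UN_equiv_class[OF cong_equiv[OF I] this] assms(2)
  show ?thesis by (simp add: mv_quot_def mv_class_def)
qed

lemmas quot_simps = quot_carrier quot_zero quot_add quot_neg

lemma quot_mv_algebra:
  assumes I: "mv_ideal A I"
  shows "mv_algebra (mv_quot A I)"
proof (rule mv_algebra.intro)
  show "comm_monoid \<lparr>carrier = carrier (mv_quot A I), mult = mv_add (mv_quot A I),
      one = mv_zero (mv_quot A I)\<rparr>"
    by (rule comm_monoidI) (auto simp: quot_simps I add_ac)
qed (auto simp: quot_simps I exchange)

lemma class_hom: "mv_ideal A I \<Longrightarrow> mv_class A I \<in> mv_hom A (mv_quot A I)"
  by (auto simp: mv_hom_def quot_simps)

lemma quot_map_class:
  assumes I: "mv_ideal A I" and J: "mv_ideal A J" and "I \<subseteq> J" and "x \<in> carrier A"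
  shows "mv_quot_map A J (mv_class A I x) = mv_class A J x"
proof -
  have "congruent (mv_cong A I) (mv_class A J)"
    using \<open>I \<subseteq> J\<close> by (intro congruentI) (simp add: cong_iff[OF I] class_eq_iff[OF J] subset_iff)
  from UN_equiv_class[OF cong_equiv[OF I] this] assms(4)
  show ?thesis by (simp add: mv_quot_map_def mv_class_def)
qed

lemma quot_map_hom:
  assumes "mv_ideal A I" and "mv_ideal A J" and "I \<subseteq> J"
  shows "mv_quot_map A J \<in> mv_hom (mv_quot A I) (mv_quot A J)"
  using assms by (auto simp: mv_hom_def quot_simps quot_map_class)

end

section \<open>Morphisms and their kernels\<close>

lemma mv_hom_compose: "\<lbrakk>f \<in> mv_hom A B; g \<in> mv_hom B C\<rbrakk> \<Longrightarrow> (\<lambda>x. g (f x)) \<in> mv_hom A C"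
  by (auto simp: mv_hom_def Pi_iff)

context mv_algebra
begin

lemma hom_diff:
  assumes "f \<in> mv_hom A B" and "x \<in> carrier A" and "y \<in> carrier A"
  shows "f (x \<ominus> y) = mv_diff B (f x) (f y)"
  using assms by (simp add: mv_hom_def mv_diff_def)

lemma kernel_ideal:
  assumes B: "mv_algebra B" and f: "f \<in> mv_hom A B"
  shows "mv_ideal A {x \<in> carrier A. f x = \<zero>\<^bsub>B\<^esub>}"
  unfolding mv_ideal_def
proof (intro conjI ballI impI)
  interpret B: mv_algebra B by fact
  have fz: "f \<zero> = \<zero>\<^bsub>B\<^esub>" using f by (simp add: mv_hom_def)
  then show "\<zero> \<in> {x \<in> carrier A. f x = \<zero>\<^bsub>B\<^esub>}" by simp
  fix x y assume y: "y \<in> {x \<in> carrier A. f x = \<zero>\<^bsub>B\<^esub>}"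
  { assume "x \<in> carrier A" and "x \<preceq> y"
    then have "mv_le B (f x) \<zero>\<^bsub>B\<^esub>"
      using y hom_diff[OF f, of x y] fz by (simp add: mv_le_def)
    moreover have "f x \<in> carrier B" using f \<open>x \<in> carrier A\<close> by (auto simp: mv_hom_def)
    ultimately show "x \<in> {x \<in> carrier A. f x = \<zero>\<^bsub>B\<^esub>}"
      using \<open>x \<in> carrier A\<close> B.le_zeroD by simp }
  { assume "x \<in> {x \<in> carrier A. f x = \<zero>\<^bsub>B\<^esub>}"
    then show "x \<oplus> y \<in> {x \<in> carrier A. f x = \<zero>\<^bsub>B\<^esub>}"
      using y f by (simp add: mv_hom_def) }
qed auto

text \<open>A morphism that kills \<open>x \<ominus> y\<close> and \<open>y \<ominus> x\<close> sends \<open>x\<close> and \<open>y\<close> to elements each below the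
  other, so it is constant on the classes of every ideal inside its kernel.\<close>

lemma hom_factors:
  assumes B: "mv_algebra B" and f: "f \<in> mv_hom A B"
    and I: "mv_ideal A I" and ker: "I \<subseteq> {x \<in> carrier A. f x = \<zero>\<^bsub>B\<^esub>}"
  shows "\<exists>h \<in> mv_hom (mv_quot A I) B. \<forall>x \<in> carrier A. h (mv_class A I x) = f x"
proof -
  interpret B: mv_algebra B by fact
  have f_closed: "f x \<in> carrier B" if "x \<in> carrier A" for x
    using f that by (auto simp: mv_hom_def)
  have f_eq: "f x = f y"
    if "x \<in> carrier A" "y \<in> carrier A" "mv_class A I x = mv_class A I y" for x y
  proof -
    have "x \<ominus> y \<in> I" "y \<ominus> x \<in> I" using that class_eq_iff[OF I] by auto
    then have "mv_le B (f x) (f y)" "mv_le B (f y) (f x)"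
      using ker that hom_diff[OF f] by (auto simp: mv_le_def)
    then show ?thesis using that f_closed B.le_antisym by blast
  qed
  define h where "h X = f (SOME x. x \<in> carrier A \<and> mv_class A I x = X)" for X
  have h: "h (mv_class A I x) = f x" if "x \<in> carrier A" for x
    unfolding h_def using someI[of "\<lambda>y. y \<in> carrier A \<and> mv_class A I y = mv_class A I x" x] that f_eq
    by blast
  then have "h \<in> mv_hom (mv_quot A I) B"
    using f f_closed I by (auto simp: mv_hom_def quot_simps)
  with h show ?thesis by blast
qed

section \<open>The square of two ideals\<close>

lemma quot_square:
  assumes "mv_ideal A P" and "mv_ideal A I" and "mv_ideal A J" and "mv_ideal A K"
    and "P \<subseteq> I" and "P \<subseteq> J" and "I \<subseteq> K" and "J \<subseteq> K"
  shows "mv_square (mv_quot A P) (mv_quot A I) (mv_quot A J) (mv_quot A K)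
    (mv_quot_map A I) (mv_quot_map A J) (mv_quot_map A K) (mv_quot_map A K)"
  using assms by (auto simp: mv_square_def quot_mv_algebra quot_map_hom quot_carrier quot_map_class)

text \<open>Compatibility of \<open>f\<close> and \<open>g\<close> on \<open>A/P\<close> means that they induce the same morphism from \<open>A\<close>.
  Its kernel contains \<open>I\<close> because of \<open>f\<close> and \<open>J\<close> because of \<open>g\<close>, hence it contains their sum.
  So any ideal \<open>P\<close> below both \<open>I\<close> and \<open>J\<close> will do.\<close>

lemma quot_pushout:
  assumes P: "mv_ideal A P" and I: "mv_ideal A I" and J: "mv_ideal A J"
    and PI: "P \<subseteq> I" and PJ: "P \<subseteq> J"
  defines "K \<equiv> ideal_sum I J"
  shows "mv_pushout TYPE('t) (mv_quot A P) (mv_quot A I) (mv_quot A J) (mv_quot A K)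
    (mv_quot_map A I) (mv_quot_map A J) (mv_quot_map A K) (mv_quot_map A K)"
  unfolding mv_pushout_def
proof (intro conjI allI impI; (elim conjE)?)
  have K: "mv_ideal A K" and IK: "I \<subseteq> K" and JK: "J \<subseteq> K"
    using I J by (simp_all add: K_def ideal_sum_ideal ideal_sum_upper)
  show "mv_square (mv_quot A P) (mv_quot A I) (mv_quot A J) (mv_quot A K)
    (mv_quot_map A I) (mv_quot_map A J) (mv_quot_map A K) (mv_quot_map A K)"
    using P I J K PI PJ IK JK by (rule quot_square)
  fix T :: "'t mv_algebra" and f g
  assume T: "mv_algebra T" and f: "f \<in> mv_hom (mv_quot A I) T" and g: "g \<in> mv_hom (mv_quot A J) T"
    and fg: "\<forall>x \<in> carrier (mv_quot A P). f (mv_quot_map A I x) = g (mv_quot_map A J x)"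
  have eq: "f (mv_class A I x) = g (mv_class A J x)" if "x \<in> carrier A" for x
    using fg that by (simp add: quot_carrier quot_map_class P I J PI PJ)
  let ?\<phi> = "\<lambda>x. f (mv_class A I x)"
  let ?N = "{x \<in> carrier A. ?\<phi> x = \<zero>\<^bsub>T\<^esub>}"
  have \<phi>: "?\<phi> \<in> mv_hom A T" using mv_hom_compose[OF class_hom[OF I] f] .
  have z: "mv_class A L x = mv_class A L \<zero>" if "mv_ideal A L" "x \<in> L" for L x
    using that ideal_carrier[OF that] ideal_zero[OF that(1)] zero_le[of x]
      ideal_down[OF that(1) diff_le that(2)]
    by (simp add: class_eq_iff mv_le_def)
  have "f (mv_class A I \<zero>) = \<zero>\<^bsub>T\<^esub>" "g (mv_class A J \<zero>) = \<zero>\<^bsub>T\<^esub>"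
    using f g by (simp_all add: mv_hom_def quot_zero)
  then have "I \<subseteq> ?N" "J \<subseteq> ?N"
    using z[OF I] z[OF J] ideal_carrier[OF I] ideal_carrier[OF J] eq by auto
  then have "K \<subseteq> ?N"
    unfolding K_def by (rule ideal_sum_least[OF kernel_ideal[OF T \<phi>]])
  from hom_factors[OF T \<phi> K this]
  obtain h where h: "h \<in> mv_hom (mv_quot A K) T"
    and h_class: "\<And>x. x \<in> carrier A \<Longrightarrow> h (mv_class A K x) = ?\<phi> x"
    by blast
  show "\<exists>h \<in> mv_hom (mv_quot A K) T.
      (\<forall>b \<in> carrier (mv_quot A I). h (mv_quot_map A K b) = f b) \<and>
      (\<forall>c \<in> carrier (mv_quot A J). h (mv_quot_map A K c) = g c) \<and>
      (\<forall>h' \<in> mv_hom (mv_quot A K) T.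
        (\<forall>b \<in> carrier (mv_quot A I). h' (mv_quot_map A K b) = f b) \<and>
        (\<forall>c \<in> carrier (mv_quot A J). h' (mv_quot_map A K c) = g c) \<longrightarrow>
        (\<forall>d \<in> carrier (mv_quot A K). h' d = h d))"
    using h by (intro bexI[of _ h]) (auto simp: quot_carrier quot_map_class I J K IK JK h_class eq)
qed

text \<open>Agreement of \<open>b\<close> with \<open>b\<^sub>1\<close> modulo \<open>I\<close> means \<open>b \<le> b\<^sub>1 \<oplus> i\<close> and \<open>b\<^sub>1 \<le> b \<oplus> i\<close> for some
  \<open>i \<in> I\<close>, that is, \<open>b\<close> lies between \<open>b\<^sub>1 \<ominus> i\<close> and \<open>b\<^sub>1 \<oplus> i\<close>. Forcing \<open>b\<^sub>2\<close> into this interval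
  changes it by no more than the part \<open>j\<close> of the distance that \<open>i\<close> does not cover.\<close>

lemma chinese_remainder:
  assumes I: "mv_ideal A I" and J: "mv_ideal A J"
    and [simp]: "b1 \<in> carrier A" "b2 \<in> carrier A"
    and eq: "mv_class A (ideal_sum I J) b1 = mv_class A (ideal_sum I J) b2"
  shows "\<exists>b \<in> carrier A. mv_class A I b = mv_class A I b1 \<and> mv_class A J b = mv_class A J b2"
proof -
  have "b1 \<ominus> b2 \<in> ideal_sum I J" "b2 \<ominus> b1 \<in> ideal_sum I J"
    using eq I J by (simp_all add: class_eq_iff ideal_sum_ideal)
  then have "(b1 \<ominus> b2) \<oplus> (b2 \<ominus> b1) \<in> ideal_sum I J"
    using I J by (simp add: ideal_add ideal_sum_ideal)
  then obtain i j where i: "i \<in> I" and j: "j \<in> J"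
    and d: "(b1 \<ominus> b2) \<oplus> (b2 \<ominus> b1) \<preceq> i \<oplus> j"
    by (auto simp: ideal_sum_def)
  have [simp]: "i \<in> carrier A" "j \<in> carrier A"
    using ideal_carrier[OF I i] ideal_carrier[OF J j] .
  have "b1 \<ominus> b2 \<preceq> i \<oplus> j" "b2 \<ominus> b1 \<preceq> i \<oplus> j"
    using d le_trans[OF le_add d] le_trans[OF le_add' d] by simp_all
  then have b1_le: "b1 \<preceq> b2 \<oplus> (i \<oplus> j)" and b2_le: "b2 \<preceq> b1 \<oplus> (i \<oplus> j)"
    by (simp_all add: diff_le_iff)
  \<comment> \<open>Truncate \<open>b2\<close> from above, then from below.\<close>
  define m where "m = mv_inf A b2 (b1 \<oplus> i)"
  define b where "b = mv_sup A (b1 \<ominus> i) m"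
  have [simp]: "m \<in> carrier A" by (simp add: m_def mv_inf_closed)
  have [simp]: "b \<in> carrier A" by (simp add: b_def mv_sup_closed)
  have m_le: "m \<preceq> b2" "m \<preceq> b1 \<oplus> i"
    by (simp_all add: m_def mv_inf_le1 mv_inf_le2)
  have le_b: "b1 \<ominus> i \<preceq> b" "m \<preceq> b"
    by (simp_all add: b_def le_mv_sup1 le_mv_sup2)
  have "b1 \<ominus> i \<preceq> b1 \<oplus> i"
    by (rule le_trans[of _ b1]) simp_all
  then have "b \<preceq> b1 \<oplus> i"
    using m_le by (simp add: b_def mv_sup_le)
  moreover have "b1 \<preceq> b \<oplus> i"
    using le_b by (simp add: diff_le_iff add_comm)
  moreover have "b \<preceq> b2 \<oplus> j"
  proof -
    have "b1 \<ominus> i \<preceq> b2 \<oplus> j"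
      using b1_le by (simp add: diff_le_iff add_ac)
    moreover have "m \<preceq> b2 \<oplus> j"
      using m_le(1) by (rule le_trans) simp_all
    ultimately show ?thesis by (simp add: b_def mv_sup_le)
  qed
  moreover have "b2 \<preceq> b \<oplus> j"
  proof -
    have "b2 \<ominus> j \<preceq> b1 \<oplus> i"
      using b2_le by (simp add: diff_le_iff add_ac)
    then have "b2 \<ominus> j \<preceq> m"
      by (simp add: m_def le_mv_inf)
    then have "b2 \<ominus> j \<preceq> b"
      using le_b(2) by (rule le_trans) simp_all
    then show ?thesis by (simp add: diff_le_iff add_comm)
  qed
  ultimately show ?thesis
    using i j by (intro bexI[of _ b]) (auto simp: class_eq_iff I J ideal_diff_iff)
qed

lemma class_Int_eq_iff:
  assumes "mv_ideal A I" and "mv_ideal A J" and "x \<in> carrier A" and "y \<in> carrier A"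
  shows "mv_class A (I \<inter> J) x = mv_class A (I \<inter> J) y
    \<longleftrightarrow> mv_class A I x = mv_class A I y \<and> mv_class A J x = mv_class A J y"
  using assms by (auto simp: class_eq_iff ideal_Int)

end

text \<open>Limits of algebras are computed on carriers. The map induced by \<open>f\<close> and \<open>g\<close> sends \<open>t\<close> to the
  one point over \<open>(f t, g t)\<close>; it is a morphism because \<open>p\<close> and \<open>q\<close> jointly separate points.\<close>

lemma mv_pullbackI:
  assumes sq: "mv_square P B C D p q r s"
    and ex: "\<And>b c. \<lbrakk>b \<in> carrier B; c \<in> carrier C; r b = s c\<rbrakk>
      \<Longrightarrow> \<exists>x \<in> carrier P. p x = b \<and> q x = c"
    and inj: "\<And>x y. \<lbrakk>x \<in> carrier P; y \<in> carrier P; p x = p y; q x = q y\<rbrakk> \<Longrightarrow> x = y"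
  shows "mv_pullback TYPE('t) P B C D p q r s"
  unfolding mv_pullback_def
proof (intro conjI allI impI; (elim conjE)?)
  interpret P: mv_algebra P using sq by (simp add: mv_square_def)
  have p: "p \<in> mv_hom P B" and q: "q \<in> mv_hom P C" using sq by (simp_all add: mv_square_def)
  show "mv_square P B C D p q r s" by (rule sq)
  fix T :: "'t mv_algebra" and f g
  assume "mv_algebra T" and f: "f \<in> mv_hom T B" and g: "g \<in> mv_hom T C"
    and fg: "\<forall>t \<in> carrier T. r (f t) = s (g t)"
  interpret T: mv_algebra T by fact
  have "\<forall>t \<in> carrier T. \<exists>x. x \<in> carrier P \<and> p x = f t \<and> q x = g t"
    using ex fg f g by (fastforce simp: mv_hom_def)
  then obtain h where h: "\<And>t. t \<in> carrier T \<Longrightarrow> h t \<in> carrier P \<and> p (h t) = f t \<and> q (h t) = g t"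
    by metis
  have "h \<in> mv_hom T P"
    unfolding mv_hom_def
  proof (intro CollectI conjI ballI)
    show "h \<in> carrier T \<rightarrow> carrier P" using h by simp
    show "h \<zero>\<^bsub>T\<^esub> = \<zero>\<^bsub>P\<^esub>"
      using h f g p q by (intro inj) (auto simp: mv_hom_def)
  next
    fix t u assume "t \<in> carrier T" "u \<in> carrier T"
    then show "h (t \<oplus>\<^bsub>T\<^esub> u) = h t \<oplus>\<^bsub>P\<^esub> h u"
      using h f g p q by (intro inj) (auto simp: mv_hom_def)
  next
    fix t assume "t \<in> carrier T"
    then show "h (\<sim>\<^bsub>T\<^esub> t) = \<sim>\<^bsub>P\<^esub> h t"
      using h f g p q by (intro inj) (auto simp: mv_hom_def)
  qed
  moreover have "h' t = h t"
    if "h' \<in> mv_hom T P" "\<forall>t \<in> carrier T. p (h' t) = f t \<and> q (h' t) = g t" "t \<in> carrier T" for h' t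
    using that h by (intro inj) (auto simp: mv_hom_def)
  ultimately show "\<exists>h \<in> mv_hom T P. (\<forall>t \<in> carrier T. p (h t) = f t \<and> q (h t) = g t) \<and>
      (\<forall>h' \<in> mv_hom T P. (\<forall>t \<in> carrier T. p (h' t) = f t \<and> q (h' t) = g t) \<longrightarrow>
        (\<forall>t \<in> carrier T. h' t = h t))"
    using h by blast
qed

lemma (in mv_algebra) quot_pullback:
  assumes I: "mv_ideal A I" and J: "mv_ideal A J"
  defines "P \<equiv> I \<inter> J" and "K \<equiv> ideal_sum I J"
  shows "mv_pullback TYPE('t) (mv_quot A P) (mv_quot A I) (mv_quot A J) (mv_quot A K)
    (mv_quot_map A I) (mv_quot_map A J) (mv_quot_map A K) (mv_quot_map A K)"
proof (rule mv_pullbackI)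
  have P: "mv_ideal A P" and K: "mv_ideal A K"
    and PI: "P \<subseteq> I" and PJ: "P \<subseteq> J" and IK: "I \<subseteq> K" and JK: "J \<subseteq> K"
    using I J by (simp_all add: P_def K_def ideal_Int ideal_sum_ideal ideal_sum_upper)
  note map_class = quot_map_class[OF P I PI] quot_map_class[OF P J PJ]
    quot_map_class[OF I K IK] quot_map_class[OF J K JK]
  show "mv_square (mv_quot A P) (mv_quot A I) (mv_quot A J) (mv_quot A K)
    (mv_quot_map A I) (mv_quot_map A J) (mv_quot_map A K) (mv_quot_map A K)"
    using P I J K PI PJ IK JK by (rule quot_square)
  show "\<exists>x \<in> carrier (mv_quot A P). mv_quot_map A I x = b \<and> mv_quot_map A J x = c"
    if "b \<in> carrier (mv_quot A I)" "c \<in> carrier (mv_quot A J)"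
      "mv_quot_map A K b = mv_quot_map A K c" for b c
  proof -
    from that obtain b1 b2 where *: "b1 \<in> carrier A" "b2 \<in> carrier A"
        "b = mv_class A I b1" "c = mv_class A J b2"
      by (auto simp: quot_carrier)
    with that(3) have "mv_class A K b1 = mv_class A K b2" by (simp add: map_class)
    with chinese_remainder[OF I J *(1,2)] * show ?thesis
      by (auto simp: quot_carrier map_class K_def)
  qed
  show "x = y"
    if "x \<in> carrier (mv_quot A P)" "y \<in> carrier (mv_quot A P)"
      "mv_quot_map A I x = mv_quot_map A I y" "mv_quot_map A J x = mv_quot_map A J y" for x y
    using that class_Int_eq_iff[OF I J, folded P_def] by (clarsimp simp: quot_carrier map_class)
qed

section \<open>The square of two elements\<close>

theorem lemma3p11:
  fixes A :: "'a mv_algebra" and a1 a2 :: 'a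
  assumes "mv_algebra A" and "a1 \<in> carrier A" and "a2 \<in> carrier A"
  shows "mv_pushout TYPE('t)
      (mv_quot_by A (mv_inf A a1 a2)) (mv_quot_by A a1)
      (mv_quot_by A a2) (mv_quot_by A (mv_sup A a1 a2))
      (mv_map_by A a1) (mv_map_by A a2)
      (mv_map_by A (mv_sup A a1 a2)) (mv_map_by A (mv_sup A a1 a2))
    \<and> mv_pullback TYPE('t)
      (mv_quot_by A (mv_inf A a1 a2)) (mv_quot_by A a1)
      (mv_quot_by A a2) (mv_quot_by A (mv_sup A a1 a2))
      (mv_map_by A a1) (mv_map_by A a2)
      (mv_map_by A (mv_sup A a1 a2)) (mv_map_by A (mv_sup A a1 a2))
    \<and> (\<forall>b1 \<in> carrier A. \<forall>b2 \<in> carrier A.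
      mv_class_by A (mv_sup A a1 a2) b1 = mv_class_by A (mv_sup A a1 a2) b2 \<longrightarrow>
      (\<exists>b \<in> carrier A.
         mv_class_by A a1 b = mv_class_by A a1 b1 \<and>
         mv_class_by A a2 b = mv_class_by A a2 b2 \<and>
         (\<forall>b' \<in> carrier A.
            mv_class_by A a1 b' = mv_class_by A a1 b1 \<and>
            mv_class_by A a2 b' = mv_class_by A a2 b2 \<longrightarrow>
            mv_class_by A (mv_inf A a1 a2) b' = mv_class_by A (mv_inf A a1 a2) b)))"
proof -
  interpret mv_algebra A by fact
  let ?I = "mv_principal A a1" and ?J = "mv_principal A a2"
  have I: "mv_ideal A ?I" and J: "mv_ideal A ?J"
    using assms by (simp_all add: principal_ideal)
  have P: "mv_principal A (mv_inf A a1 a2) = ?I \<inter> ?J"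
    and K: "mv_principal A (mv_sup A a1 a2) = ideal_sum ?I ?J"
    using assms by (simp_all add: principal_inf principal_sup)
  show ?thesis
    unfolding P K
  proof (intro conjI ballI impI)
    fix b1 b2 assume "b1 \<in> carrier A" "b2 \<in> carrier A"
      and "mv_class A (ideal_sum ?I ?J) b1 = mv_class A (ideal_sum ?I ?J) b2"
    from chinese_remainder[OF I J this]
    show "\<exists>b \<in> carrier A.
         mv_class_by A a1 b = mv_class_by A a1 b1 \<and>
         mv_class_by A a2 b = mv_class_by A a2 b2 \<and>
         (\<forall>b' \<in> carrier A.
            mv_class_by A a1 b' = mv_class_by A a1 b1 \<and>
            mv_class_by A a2 b' = mv_class_by A a2 b2 \<longrightarrow>
            mv_class A (?I \<inter> ?J) b' = mv_class A (?I \<inter> ?J) b)"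
      using class_Int_eq_iff[OF I J] by metis
  qed (fact quot_pushout[OF ideal_Int[OF I J] I J Int_lower1 Int_lower2] quot_pullback[OF I J])+
qed

end
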